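(* Let $T>0$, $I=[0,T]$, let $\mathcal{H}_1,\mathcal{H}_2$ be real Hilbert spaces, let $\Omega\subset\mathcal{H}_2$ be nonempty, closed and convex, let $K:\Omega\to 2^{\Omega}$ be a set-valued mapping with nonempty closed convex values, and let $G:I\times\mathcal{H}_1\times\Omega\to\mathcal{H}_2$. Assume: (1) there are constants $l_G,\eta_G>0$ such that $\|G(s_2,x_2,u_2)-G(s_1,x_1,u_1)\|\le l_G(|s_2-s_1|+\|x_2-x_1\|+\|u_2-u_1\|)$ for all $s_1,s_2\in I$, $x_1,x_2\in\mathcal{H}_1$, $u_1,u_2\in\Omega$, and, for all $s\in I$, $x\in\mathcal{H}_1$, $u\in\Omega$ and $u_1,u_2\in K(u)$, $$\langle G(s,x,u_2),u_1-u_2\rangle\ge 0\ \Rightarrow\ \langle G(s,x,u_1),u_1-u_2\rangle\ge\eta_G\|u_1-u_2\|^2;$$ (2) there is a constant $l_K\ge 0$ such that $\|P_{K(u_2)}[\varpi]-P_{K(u_1)}[\varpi]\|\le l_K\|u_2-u_1\|$ for all $u_1,u_2\in\Omega$ and $\varpi\in\mathcal{H}_2$; (3) $L:=2\dfrac{l_K^2}{\eta_G^2}\left(l_G\sqrt{4l_G^2+2\eta_G^2}+2l_G^2+\eta_G^2\right)<1$. Then for each fixed $s\in I$ and $x\in C(I,\mathcal{H}_1)$ there exists a unique $u(s)\in K(u(s))\subset\Omega$ such that $$\langle G(s,x(s),u(s)),v-u(s)\rangle\ge 0\quad\text{for all } v\in K(u(s)).\qquad( * )$$ Moreover, for each $x\in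 C(I,\mathcal{H}_1)$ the solution function $u:I\to\Omega$, $s\mapsto u(s)$, is continuous. In addition, if $u_1$ and $u_2$ are the solution functions of $( * )$ associated with $x=x_1\in C(I,\mathcal{H}_1)$ and $x=x_2\in C(I,\mathcal{H}_1)$, respectively, then $$\|u_1(s)-u_2(s)\|\le\sqrt{\frac{\kappa}{1-L}}\,\|x_1(s)-x_2(s)\|\quad\text{for all } s\in I,$$ where $$\kappa=2\,\frac{l_G\left(\sqrt{l_G^2+\frac12\eta_G^2}+l_G\right)^2}{\eta_G^2\sqrt{l_G^2+\frac12\eta_G^2}}.$$
   Context: $P_{C}$ denotes the metric projection of a real Hilbert space onto a nonempty closed convex subset $C$. $C(I,\mathcal{H}_1)$ is the space of continuous functions $I\to\mathcal{H}_1$. *)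

theory Defs
  imports "HOL-Analysis.Analysis"
begin

(* The library's closest_point is restricted to heine_borel (finite-dimensional) spaces,
   hence this version for arbitrary real Hilbert spaces.  The description is well defined
   when C is nonempty, closed and convex. *)
definition metric_proj :: "'a::{real_inner,complete_space} set \<Rightarrow> 'a \<Rightarrow> 'a" where
  "metric_proj C w = (THE p. p \<in> C \<and> (\<forall>q\<in>C. dist w p \<le> dist w q))"

(* The explicit membership in \<Omega> is needed because K and F are total functions here, and
   their values outside \<Omega> are irrelevant. *)
definition qvi_solution ::
    "'b::real_inner set \<Rightarrow> ('b \<Rightarrow> 'b set) \<Rightarrow> ('b \<Rightarrow> 'b) \<Rightarrow> 'b \<Rightarrow> bool" where
  "qvi_solution \<Omega> K F u \<longleftrightarrow>
     u \<in> \<Omega> \<and> u \<in> K u \<and> (\<forall>v\<in>K u. inner (F u) (v - u) \<ge> 0)"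

definition qvi_solution_function ::
    "real \<Rightarrow> 'b::real_inner set \<Rightarrow> ('b \<Rightarrow> 'b set) \<Rightarrow> (real \<Rightarrow> 'a \<Rightarrow> 'b \<Rightarrow> 'b) \<Rightarrow>
      (real \<Rightarrow> 'a) \<Rightarrow> (real \<Rightarrow> 'b) \<Rightarrow> bool" where
  "qvi_solution_function T \<Omega> K G x u \<longleftrightarrow>
     (\<forall>s\<in>{0..T}. qvi_solution \<Omega> K (G s (x s)) (u s))"

end

theory Submission
  imports Defs
begin

text \<open>
  For fixed time and state the quasi-variational inequality is a fixed-point problem: send
  \<open>u\<close> to the solution of the ordinary variational inequality over the set \<open>K u\<close>, held fixed.  Two facts
  about ordinary variational inequalities for a strongly pseudomonotone Lipschitz operator carry
  the proof.

  Existence (\<open>vi_solution_exists\<close>).  Strong pseudomonotonicity confines any solution, for every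
  test point \<open>x\<close> of \<open>C\<close>, to a closed ball \<open>B x\<close> determined by \<open>x\<close> and \<open>F x\<close>, and a point
  lying in all these balls is conversely a solution, because one may let the test point run along a
  segment towards it.  The balls cover in the sense of Knaster, Kuratowski and Mazurkiewicz: a point
  of the hull of finitely many test points lies in one of their balls.  As the balls are convex,
  the covering principle has an elementary proof by separating hyperplanes (\<open>convex_KKM\<close>),
  valid in every dimension.  It yields common points of finitely many
  balls; points of least norm in the finite intersections converge to a point common to all
  (\<open>closed_convex_finite_intersection_property\<close>).

  Sensitivity (\<open>vi_solution_sensitivity\<close>).  Solutions \<open>y\<close>, \<open>y'\<close> of two problems over \<open>C\<close>, \<open>C'\<close> whose
  projections differ by at most \<open>h\<close>, with operators that differ by data at distance \<open>\<delta>\<close>, satisfy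
  \<open>norm (y - y') \<le> (1 + l/\<eta>) * h + (l/\<eta>) * \<delta>\<close>.  One compares \<open>y\<close> with the projection onto \<open>C\<close>
  of \<open>y' - \<rho> F' y'\<close>, whose projection onto \<open>C'\<close> is \<open>y'\<close>, and lets the step size \<open>\<rho>\<close> tend to
  infinity.

  Take \<open>h = l\<^sub>K * norm (u - u')\<close>.  The map above is then Lipschitz with constant
  \<open>c = (1 + l\<^sub>G/\<eta>\<^sub>G) * l\<^sub>K\<close>, and \<open>c\<^sup>2 \<le> 5/8 * L < 1\<close>, so Banach's theorem gives the solution.
  For two solutions of the quasi-variational inequality the estimate reads
  \<open>d \<le> c * d + r * \<delta>\<close> with \<open>d\<close> their distance and \<open>r = l\<^sub>G/\<eta>\<^sub>G\<close>.  With \<open>\<delta> = 0\<close> this is uniqueness;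
  with \<open>\<delta>\<close> the distance of times and states it is continuity; and together with \<open>8 * r\<^sup>2 \<le> \<kappa>\<close> a
  weighted square of it gives the stated bound.
\<close>

section \<open>Nearest points in Hilbert space\<close>

lemma dist_square_le_of_infdist:
  fixes S :: "'a::real_inner set"
  assumes "convex S" "x \<in> S" "y \<in> S" "dist w x \<le> r" "dist w y \<le> r"
  shows "(dist x y)\<^sup>2 \<le> 4 * (r\<^sup>2 - (infdist w S)\<^sup>2)"
proof -
  let ?m = "(1/2) *\<^sub>R x + (1/2) *\<^sub>R y"
  have "?m \<in> S"
    using assms by (intro convexD) auto
  then have "infdist w S \<le> dist w ?m"
    by (rule infdist_le)
  then have 1: "(infdist w S)\<^sup>2 \<le> (dist w ?m)\<^sup>2"
    by (intro power_mono infdist_nonneg)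
  have 2: "(dist w x)\<^sup>2 \<le> r\<^sup>2" "(dist w y)\<^sup>2 \<le> r\<^sup>2"
    using assms by (auto intro: power_mono)
  have "(dist x y)\<^sup>2 = 2 * (dist w x)\<^sup>2 + 2 * (dist w y)\<^sup>2 - 4 * (dist w ?m)\<^sup>2"
    unfolding dist_norm power2_norm_eq_inner
    by (simp add: inner_diff inner_add inner_commute algebra_simps)
  with 1 2 show ?thesis by simp
qed

text \<open>
  In place of compactness, the parallelogram estimate above makes the diameters of the sets of
  almost nearest points shrink to zero, and completeness provides a point common to them.
\<close>

lemma nearest_point_exists:
  fixes S :: "'a::{real_inner,complete_space} set"
  assumes S: "closed S" "convex S" "S \<noteq> {}"
  obtains p where "p \<in> S" "\<And>q. q \<in> S \<Longrightarrow> dist w p \<le> dist w q"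
proof -
  define d where "d = infdist w S"
  define N where "N n = S \<inter> cball w (d + 1 / real (Suc n))" for n
  have "\<exists>p. \<forall>n. p \<in> N n"
  proof (rule decreasing_closed_nest)
    show "closed (N n)" for n
      using S by (simp add: N_def closed_Int)
    show "N n \<noteq> {}" for n
    proof -
      have "bdd_below (dist w ` S)" by (rule bdd_belowI2[of _ 0]) simp
      moreover have "(INF y\<in>S. dist w y) < d + 1 / real (Suc n)"
        by (simp add: d_def infdist_notempty[OF S(3)])
      ultimately obtain y where "y \<in> S" "dist w y < d + 1 / real (Suc n)"
        using cINF_less_iff[OF S(3), of "dist w"] by blast
      then show ?thesis by (auto simp: N_def)
    qed
    show "N n \<subseteq> N m" if "m \<le> n" for m n
    proof -
      have "1 / real (Suc n) \<le> 1 / real (Suc m)"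
        using that by (intro divide_left_mono) auto
      then show ?thesis unfolding N_def by (intro Int_mono subset_cball) auto
    qed
    show "\<exists>n. \<forall>x\<in>N n. \<forall>y\<in>N n. dist x y < e" if "e > 0" for e
    proof -
      have "(\<lambda>n. 4 * ((d + 1 / real (Suc n))\<^sup>2 - d\<^sup>2)) \<longlonglongrightarrow> 4 * ((d + 0)\<^sup>2 - d\<^sup>2)"
        by (intro tendsto_intros LIMSEQ_Suc[OF lim_1_over_n])
      then have "eventually (\<lambda>n. 4 * ((d + 1 / real (Suc n))\<^sup>2 - d\<^sup>2) < e\<^sup>2) sequentially"
        using \<open>e > 0\<close> by (intro order_tendstoD) auto
      then obtain n where n: "4 * ((d + 1 / real (Suc n))\<^sup>2 - d\<^sup>2) < e\<^sup>2"
        using eventually_happens'[OF sequentially_bot] by blast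
      have "dist x y < e" if "x \<in> N n" "y \<in> N n" for x y
      proof -
        have "(dist x y)\<^sup>2 \<le> 4 * ((d + 1 / real (Suc n))\<^sup>2 - d\<^sup>2)"
          using that dist_square_le_of_infdist[OF S(2), of x y w "d + 1 / real (Suc n)"]
          by (simp add: N_def d_def)
        with n have "(dist x y)\<^sup>2 < e\<^sup>2" by linarith
        then show ?thesis
          by (rule power2_less_imp_less) (use \<open>e > 0\<close> in simp)
      qed
      then show ?thesis by blast
    qed
  qed blast
  then obtain p where p: "\<And>n. p \<in> N n" by blast
  have "(\<lambda>n. d + 1 / real (Suc n)) \<longlonglongrightarrow> d + 0"
    by (intro tendsto_intros LIMSEQ_Suc[OF lim_1_over_n])
  then have "dist w p \<le> d + 0"
    by (rule LIMSEQ_le_const) (use p in \<open>simp add: N_def\<close>)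
  moreover have "d \<le> dist w q" if "q \<in> S" for q
    using that by (auto simp: d_def infdist_le)
  moreover have "p \<in> S" using p by (simp add: N_def)
  ultimately show ?thesis by (intro that[of p]) (simp, force)
qed

lemma metric_proj_properties:
  fixes S :: "'a::{real_inner,complete_space} set"
  assumes S: "closed S" "convex S" "S \<noteq> {}"
  shows "metric_proj S w \<in> S" "\<And>v. v \<in> S \<Longrightarrow> inner (w - metric_proj S w) (v - metric_proj S w) \<le> 0"
proof -
  obtain p where p: "p \<in> S" "\<And>q. q \<in> S \<Longrightarrow> dist w p \<le> dist w q"
    using nearest_point_exists[OF S] by blast
  have "metric_proj S w = p"
    unfolding metric_proj_def
  proof (rule the_equality)
    show "q = p" if "q \<in> S \<and> (\<forall>v\<in>S. dist w q \<le> dist w v)" for q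
      using that p by (intro any_closest_point_unique[OF S(2,1), of q p w]) simp_all
  qed (simp add: p)
  then show "metric_proj S w \<in> S"
    using p(1) by simp
  show "inner (w - metric_proj S w) (v - metric_proj S w) \<le> 0" if "v \<in> S" for v
    unfolding \<open>metric_proj S w = p\<close>
    by (rule any_closest_point_dot[OF S(2,1) p(1) that]) (simp add: p(2))
qed

lemma metric_proj_eqI:
  fixes S :: "'a::{real_inner,complete_space} set"
  assumes S: "closed S" "convex S" and p: "p \<in> S" "\<And>v. v \<in> S \<Longrightarrow> inner (w - p) (v - p) \<le> 0"
  shows "metric_proj S w = p"
proof -
  define m where "m = metric_proj S w"
  have "S \<noteq> {}" using p by auto
  then have "m \<in> S" "inner (w - m) (p - m) \<le> 0"
    using metric_proj_properties[OF S, where w = w] p by (auto simp: m_def)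
  moreover from this have "inner (w - p) (m - p) \<le> 0" using p by auto
  ultimately have "inner (m - p) (m - p) \<le> 0"
    by (simp add: inner_diff inner_commute)
  then have "m - p = 0"
    by (metis inner_eq_zero_iff inner_ge_zero order_antisym)
  then show ?thesis by (simp add: m_def)
qed

section \<open>Intersections of closed convex sets\<close>

text \<open>
  This replaces weak compactness of bounded closed convex sets.  Let \<open>p J\<close> be the point of least norm
  in the intersection of the sets with index in \<open>J\<close>.  Enlarging \<open>J\<close> increases the norm, and
  the square of the distance moved is at most the gain in the squared norm.  Once
  \<open>p J\<close> has almost maximal norm it can therefore hardly move when further sets are included, so that
  the limit of such points lies in every set.
\<close>

lemma closed_convex_finite_intersection_property:
  fixes A :: "'i \<Rightarrow> 'a::{real_inner,complete_space} set"
  assumes A: "\<And>i. i \<in> I \<Longrightarrow> closed (A i)" "\<And>i. i \<in> I \<Longrightarrow> convex (A i)"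
    and i0: "i0 \<in> I" "bounded (A i0)"
    and fip: "\<And>J. \<lbrakk>finite J; J \<subseteq> I\<rbrakk> \<Longrightarrow> (\<Inter>i\<in>J. A i) \<noteq> {}"
  shows "(\<Inter>i\<in>I. A i) \<noteq> {}"
proof -
  define Fin where "Fin = {J. finite J \<and> J \<subseteq> I}"
  define p where "p J = metric_proj (\<Inter>i\<in>J. A i) 0" for J
  have props: "closed (\<Inter>i\<in>J. A i)" "convex (\<Inter>i\<in>J. A i)" "(\<Inter>i\<in>J. A i) \<noteq> {}" if "J \<in> Fin" for J
    using that A fip by (auto simp: Fin_def intro!: closed_INT convex_INT)
  have p_in: "p J \<in> (\<Inter>i\<in>J. A i)" if "J \<in> Fin" for J
    using metric_proj_properties(1)[OF props[OF that]] by (simp add: p_def)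
  have p_mono: "(norm (p J))\<^sup>2 + (dist (p J') (p J))\<^sup>2 \<le> (norm (p J'))\<^sup>2"
    if "J \<in> Fin" "J' \<in> Fin" "J \<subseteq> J'" for J J'
  proof -
    have "p J' \<in> (\<Inter>i\<in>J. A i)" using p_in[OF that(2)] that(3) by auto
    then have "inner (0 - p J) (p J' - p J) \<le> 0"
      using metric_proj_properties(2)[OF props[OF that(1)], of "p J'" 0] by (simp add: p_def)
    then show ?thesis
      unfolding dist_norm power2_norm_eq_inner by (simp add: inner_diff inner_commute)
  qed
  obtain M where M: "\<And>y. y \<in> A i0 \<Longrightarrow> norm y \<le> M"
    using i0(2) by (auto simp: bounded_iff)
  have p_bound: "(norm (p J))\<^sup>2 \<le> M\<^sup>2" if "J \<in> Fin" for J
  proof -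
    have J': "insert i0 J \<in> Fin" using that i0 by (auto simp: Fin_def)
    have "(norm (p J))\<^sup>2 \<le> (norm (p (insert i0 J)))\<^sup>2"
      using p_mono[OF that J'] by (smt (verit) subset_insertI zero_le_power2)
    also have "\<dots> \<le> M\<^sup>2"
      using p_in[OF J'] M by (intro power_mono) auto
    finally show ?thesis .
  qed
  define \<sigma> where "\<sigma> = (SUP J\<in>Fin. (norm (p J))\<^sup>2)"
  have bdd: "bdd_above ((\<lambda>J. (norm (p J))\<^sup>2) ` Fin)"
    using p_bound by (auto intro!: bdd_aboveI)
  have ne: "Fin \<noteq> {}" by (auto simp: Fin_def)
  have "\<exists>J. J \<in> Fin \<and> \<sigma> - 1 / real (Suc n) < (norm (p J))\<^sup>2" for n
    using less_cSUP_iff[OF ne bdd, of "\<sigma> - 1 / real (Suc n)"] unfolding \<sigma>_def[symmetric] by auto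
  then obtain J where J: "\<And>n. J n \<in> Fin" "\<And>n. \<sigma> - 1 / real (Suc n) < (norm (p (J n)))\<^sup>2"
    by metis
  have near: "dist (p J') (p (J n)) \<le> sqrt (1 / real (Suc n))" if "J' \<in> Fin" "J n \<subseteq> J'" for J' n
  proof (rule real_le_rsqrt)
    have "(norm (p J'))\<^sup>2 \<le> \<sigma>"
      unfolding \<sigma>_def by (rule cSUP_upper[OF that(1) bdd])
    then show "(dist (p J') (p (J n)))\<^sup>2 \<le> 1 / real (Suc n)"
      using J(2)[of n] p_mono[OF J(1) that] by linarith
  qed
  have r0: "(\<lambda>n. sqrt (1 / real (Suc n))) \<longlonglongrightarrow> 0"
    using tendsto_real_sqrt[OF LIMSEQ_Suc[OF lim_1_over_n]] by simp
  have "Cauchy (\<lambda>n. p (J n))"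
  proof (rule metric_CauchyI)
    fix e :: real assume "e > 0"
    then have "eventually (\<lambda>n. sqrt (1 / real (Suc n)) < e / 2) sequentially"
      using r0 by (intro order_tendstoD) auto
    then obtain N where N: "\<And>n. n \<ge> N \<Longrightarrow> sqrt (1 / real (Suc n)) < e / 2"
      unfolding eventually_sequentially by blast
    have "dist (p (J m)) (p (J n)) < e" if "m \<ge> N" "n \<ge> N" for m n
    proof -
      have "J m \<union> J n \<in> Fin" using J(1)[of m] J(1)[of n] by (auto simp: Fin_def)
      then have "dist (p (J m \<union> J n)) (p (J m)) < e / 2" "dist (p (J m \<union> J n)) (p (J n)) < e / 2"
        using near[of "J m \<union> J n" m] near[of "J m \<union> J n" n] N that by (force intro: le_less_trans)+
      then show ?thesis by (rule dist_triangle_half_r)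
    qed
    then show "\<exists>N. \<forall>m\<ge>N. \<forall>n\<ge>N. dist (p (J m)) (p (J n)) < e" by blast
  qed
  then obtain q where q: "(\<lambda>n. p (J n)) \<longlonglongrightarrow> q"
    using Cauchy_convergent convergent_def by blast
  have "q \<in> A i" if "i \<in> I" for i
  proof -
    have Fi: "insert i (J n) \<in> Fin" for n using J(1)[of n] that by (auto simp: Fin_def)
    have "(\<lambda>n. dist (p (insert i (J n))) (p (J n))) \<longlonglongrightarrow> 0"
    proof (rule tendsto_sandwich[OF _ _ tendsto_const r0])
      have "dist (p (insert i (J n))) (p (J n)) \<le> sqrt (1 / real (Suc n))" for n
        by (rule near[OF Fi]) blast
      then show "\<forall>\<^sub>F n in sequentially. dist (p (insert i (J n))) (p (J n)) \<le> sqrt (1 / real (Suc n))"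
        by (intro always_eventually) blast
    qed simp
    then have "(\<lambda>n. p (J n) + (p (insert i (J n)) - p (J n))) \<longlonglongrightarrow> q + 0"
      by (intro tendsto_add q) (simp add: dist_norm tendsto_norm_zero_iff)
    then have "(\<lambda>n. p (insert i (J n))) \<longlonglongrightarrow> q" by simp
    moreover have "p (insert i (J n)) \<in> A i" for n using p_in[OF Fi] by auto
    ultimately show ?thesis using A(1)[OF that] by (metis closed_sequentially)
  qed
  then show ?thesis by blast
qed

lemma compact_convex_strict_separation:
  fixes A B :: "'a::real_inner set"
  assumes A: "compact A" "convex A" "A \<noteq> {}" and B: "compact B" "convex B" "B \<noteq> {}"
    and disj: "A \<inter> B = {}"
  obtains n c where "\<And>x. x \<in> A \<Longrightarrow> inner n x < c" "\<And>y. y \<in> B \<Longrightarrow> c < inner n y"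
proof -
  have "compact (A \<times> B)" "A \<times> B \<noteq> {}" using A B by (auto intro: compact_Times)
  then have "\<exists>z\<in>A \<times> B. \<forall>z'\<in>A \<times> B. dist (fst z) (snd z) \<le> dist (fst z') (snd z')"
    by (rule continuous_attains_inf) (intro continuous_intros)
  then obtain a b where ab: "a \<in> A" "b \<in> B"
    and min: "\<And>x y. \<lbrakk>x \<in> A; y \<in> B\<rbrakk> \<Longrightarrow> dist a b \<le> dist x y" by force
  have A': "inner (b - a) x \<le> inner (b - a) a" if "x \<in> A" for x
    using any_closest_point_dot[OF A(2) compact_imp_closed[OF A(1)] ab(1) that, of b] min ab
    by (simp add: dist_commute inner_diff_right)
  have B': "inner (b - a) b \<le> inner (b - a) y" if "y \<in> B" for y
  proof -
    have "inner (a - b) (y - b) \<le> 0"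
      using any_closest_point_dot[OF B(2) compact_imp_closed[OF B(1)] ab(2) that, of a] min ab by simp
    then show ?thesis by (simp add: inner_diff)
  qed
  have "a \<noteq> b" using ab disj by auto
  then have "inner (b - a) (b - a) > 0" by simp
  then have lt: "inner (b - a) a < inner (b - a) b" by (simp add: inner_diff)
  show ?thesis
  proof (rule that[of "b - a" "(inner (b - a) a + inner (b - a) b) / 2"])
    show "inner (b - a) x < (inner (b - a) a + inner (b - a) b) / 2" if "x \<in> A" for x
      using A'[OF that] lt by (simp add: field_simps)
    show "(inner (b - a) a + inner (b - a) b) / 2 < inner (b - a) y" if "y \<in> B" for y
      using B'[OF that] lt by (simp add: field_simps)
  qed
qed

text \<open>
  A theorem of Klee, by induction on the number of sets.  If no point of \<open>Y\<close> were common to all sets,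
  a hyperplane would strictly separate the part of \<open>Y\<close> common to all but one of them from the part of
  \<open>Y\<close> in the last one.  The slice of \<open>Y\<close> by this hyperplane satisfies the hypotheses for one
  set less, and the point that the induction yields would lie on the hyperplane and in the first of the
  separated parts.
\<close>

lemma convex_cover_common_point:
  fixes A :: "'i \<Rightarrow> 'a::real_inner set"
  assumes "finite I" "compact Y" "convex Y" "Y \<noteq> {}"
    and "\<And>i. i \<in> I \<Longrightarrow> closed (A i)" "\<And>i. i \<in> I \<Longrightarrow> convex (A i)"
    and "Y \<subseteq> (\<Union>i\<in>I. A i)"
    and "\<And>j. j \<in> I \<Longrightarrow> Y \<inter> (\<Inter>i\<in>I - {j}. A i) \<noteq> {}"
  shows "Y \<inter> (\<Inter>i\<in>I. A i) \<noteq> {}"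
  using assms
proof (induction I arbitrary: Y rule: finite_induct)
  case empty
  then show ?case by auto
next
  case (insert k I)
  show ?case
  proof (cases "I = {}")
    case True
    then show ?thesis using insert.prems by auto
  next
    case False
    show ?thesis
    proof
      assume contra: "Y \<inter> (\<Inter>i\<in>insert k I. A i) = {}"
      let ?B = "Y \<inter> (\<Inter>i\<in>I. A i)" and ?C = "Y \<inter> A k"
      have "insert k I - {k} = I" using insert.hyps by auto
      then have B: "compact ?B" "convex ?B" "?B \<noteq> {}"
        using insert.prems(1,2,4,5) insert.prems(7)[of k]
        by (auto intro!: compact_Int_closed closed_INT convex_Int convex_INT)
      have C_points: "\<exists>q. q \<in> ?C \<and> q \<in> (\<Inter>i\<in>I - {j}. A i)" if "j \<in> I" for j
      proof -
        have "k \<noteq> j" using that insert.hyps by auto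
        then have "insert k I - {j} = insert k (I - {j})" by auto
        then show ?thesis using insert.prems(7)[of j] that by auto
      qed
      have C: "compact ?C" "convex ?C"
        using insert.prems(1,2,4,5) by (auto intro!: compact_Int_closed convex_Int)
      have "?C \<noteq> {}" using C_points False by blast
      note C = C this
      have "?B \<inter> ?C = {}" using contra by auto
      then obtain n c where nc: "\<And>x. x \<in> ?B \<Longrightarrow> inner n x < c" "\<And>y. y \<in> ?C \<Longrightarrow> c < inner n y"
        using compact_convex_strict_separation[OF B C] by blast
      let ?H = "{x. inner n x = c}"
      have meets: "(Y \<inter> ?H) \<inter> (\<Inter>i\<in>I - {j}. A i) \<noteq> {}" if j: "j \<in> I" for j
      proof -
        \<comment> \<open>The convex set ?Z has points on both sides of the hyperplane, one in each of the
          separated sets.\<close>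
        let ?Z = "Y \<inter> (\<Inter>i\<in>I - {j}. A i)"
        obtain q where q: "q \<in> ?C" "q \<in> ?Z" using C_points[OF j] by blast
        obtain b where b: "b \<in> ?B" "b \<in> ?Z" using B(3) by blast
        have "convex ?Z" using insert.prems(2,5) by (intro convex_Int convex_INT) auto
        then have "connected ?Z" by (rule convex_connected)
        then have "\<exists>z\<in>?Z. inner n z = c"
          using nc(1)[OF b(1)] nc(2)[OF q(1)] b(2) q(2)
          by (intro connected_ivt_hyperplane[of _ b q]) auto
        then show ?thesis by auto
      qed
      have "(Y \<inter> ?H) \<inter> (\<Inter>i\<in>I. A i) \<noteq> {}"
      proof (rule insert.IH)
        show "compact (Y \<inter> ?H)"
          using insert.prems(1) by (intro compact_Int_closed closed_hyperplane)
        show "convex (Y \<inter> ?H)"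
          using insert.prems(2) by (intro convex_Int convex_hyperplane)
        show "Y \<inter> ?H \<noteq> {}" using meets False by blast
        \<comment> \<open>The set with index k misses the slice, so the others cover it.\<close>
        show "Y \<inter> ?H \<subseteq> (\<Union>i\<in>I. A i)" using insert.prems(6) nc(2) by fastforce
      qed (use insert.prems(4,5) meets in auto)
      then show False using nc(1) by fastforce
    qed
  qed
qed

text \<open>
  The covering principle of Knaster, Kuratowski and Mazurkiewicz for convex sets.  Induction on
  \<open>X\<close> provides the points common to all sets but one that the previous lemma asks for.
\<close>

lemma convex_KKM:
  fixes A :: "'a::real_inner \<Rightarrow> 'a set"
  assumes "finite X" "X \<noteq> {}"
    and "\<And>x. x \<in> X \<Longrightarrow> closed (A x)" "\<And>x. x \<in> X \<Longrightarrow> convex (A x)"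
    and "\<And>S. S \<subseteq> X \<Longrightarrow> convex hull S \<subseteq> (\<Union>x\<in>S. A x)"
  shows "convex hull X \<inter> (\<Inter>x\<in>X. A x) \<noteq> {}"
  using assms
proof (induction X rule: finite_psubset_induct)
  case (psubset X)
  show ?case
  proof (rule convex_cover_common_point)
    show "convex hull X \<inter> (\<Inter>i\<in>X - {j}. A i) \<noteq> {}" if "j \<in> X" for j
    proof (cases "X - {j} = {}")
      case True
      then show ?thesis using psubset.prems(1) by (simp only: True) simp
    next
      case False
      have "convex hull (X - {j}) \<inter> (\<Inter>i\<in>X - {j}. A i) \<noteq> {}"
      proof (rule psubset.IH)
        show "convex hull S \<subseteq> (\<Union>x\<in>S. A x)" if "S \<subseteq> X - {j}" for S
          using that by (intro psubset.prems(4)) auto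
      qed (use that False psubset.prems in auto)
      moreover have "convex hull (X - {j}) \<subseteq> convex hull X" by (intro hull_mono) auto
      ultimately show ?thesis by blast
    qed
  qed (use psubset in \<open>auto simp: finite_imp_compact_convex_hull\<close>)
qed

section \<open>Strongly pseudomonotone variational inequalities\<close>

definition vi_solution :: "'a::real_inner set \<Rightarrow> ('a \<Rightarrow> 'a) \<Rightarrow> 'a \<Rightarrow> bool" where
  "vi_solution C F y \<longleftrightarrow> y \<in> C \<and> (\<forall>v\<in>C. inner (F y) (v - y) \<ge> 0)"

definition strongly_pseudomonotone_on :: "'a::real_inner set \<Rightarrow> real \<Rightarrow> ('a \<Rightarrow> 'a) \<Rightarrow> bool" where
  "strongly_pseudomonotone_on C \<eta> F \<longleftrightarrow>
    (\<forall>x\<in>C. \<forall>y\<in>C. inner (F y) (x - y) \<ge> 0 \<longrightarrow> inner (F x) (x - y) \<ge> \<eta> * (norm (x - y))\<^sup>2)"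

text \<open>
  With \<open>g = F x\<close> the left-hand side consists of the points \<open>z\<close> that pass the strengthened Minty test
  at \<open>x\<close>.  Completing the square exhibits it as a ball, hence as closed, convex and bounded.
\<close>

lemma strong_minty_set_eq_cball:
  fixes x g :: "'a::real_inner"
  assumes "\<eta> > 0"
  shows "{z. inner g (x - z) \<ge> \<eta> * (norm (x - z))\<^sup>2} =
    cball (x - (1 / (2 * \<eta>)) *\<^sub>R g) (norm g / (2 * \<eta>))"
proof -
  have "\<eta> * (norm (x - z))\<^sup>2 \<le> inner g (x - z) \<longleftrightarrow>
    dist (x - (1 / (2 * \<eta>)) *\<^sub>R g) z \<le> norm g / (2 * \<eta>)" for z
  proof -
    define u where "u = x - z"
    have "dist (x - (1 / (2 * \<eta>)) *\<^sub>R g) z = norm (u - (1 / (2 * \<eta>)) *\<^sub>R g)"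
      by (simp add: dist_norm u_def algebra_simps)
    moreover have "norm (u - (1 / (2 * \<eta>)) *\<^sub>R g) \<le> norm g / (2 * \<eta>) \<longleftrightarrow>
        (norm (u - (1 / (2 * \<eta>)) *\<^sub>R g))\<^sup>2 \<le> (norm g / (2 * \<eta>))\<^sup>2"
      using assms by (simp add: power_mono_iff)
    moreover have "(norm (u - (1 / (2 * \<eta>)) *\<^sub>R g))\<^sup>2 =
        (norm u)\<^sup>2 - inner g u / \<eta> + (norm g / (2 * \<eta>))\<^sup>2"
      unfolding power_divide power2_norm_eq_inner
      using assms by (simp add: inner_diff inner_commute field_simps power2_eq_square)
    moreover have "\<eta> * (norm u)\<^sup>2 \<le> inner g u \<longleftrightarrow> (norm u)\<^sup>2 - inner g u / \<eta> \<le> 0"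
      using assms by (simp add: field_simps)
    ultimately show ?thesis
      by (simp add: u_def)
  qed
  then show ?thesis
    by (simp only: cball_def)
qed

text \<open>
  A point \<open>z\<close> of \<open>convex hull S\<close> outside all the balls \<open>B x\<close> with \<open>x \<in> S\<close> would satisfy
  \<open>inner (F z) (x - z) < 0\<close> for all \<open>x \<in> S\<close> by pseudomonotonicity, hence also with \<open>x\<close> replaced by
  \<open>z\<close>, which is absurd.  So the balls satisfy the covering hypothesis, and they have a
  common point in \<open>C\<close>.
\<close>

lemma vi_solution_exists:
  fixes C :: "'a::{real_inner,complete_space} set"
  assumes C: "closed C" "convex C" "C \<noteq> {}" and \<eta>: "\<eta> > 0"
    and F: "continuous_on C F" "strongly_pseudomonotone_on C \<eta> F"
  shows "\<exists>y. vi_solution C F y"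
proof -
  define B where "B x = {z. inner (F x) (x - z) \<ge> \<eta> * (norm (x - z))\<^sup>2}" for x
  have B_ball: "B x = cball (x - (1 / (2 * \<eta>)) *\<^sub>R F x) (norm (F x) / (2 * \<eta>))" for x
    unfolding B_def by (rule strong_minty_set_eq_cball[OF \<eta>])
  have kkm: "convex hull S \<subseteq> (\<Union>x\<in>S. B x)" if "S \<subseteq> C" "finite S" for S
  proof
    fix z assume z: "z \<in> convex hull S"
    then have zC: "z \<in> C" using hull_minimal[of S C convex] that C(2) by auto
    show "z \<in> (\<Union>x\<in>S. B x)"
    proof (rule ccontr)
      assume "z \<notin> (\<Union>x\<in>S. B x)"
      then have "inner (F z) (x - z) < 0" if "x \<in> S" for x
        using F(2) zC \<open>S \<subseteq> C\<close> that unfolding strongly_pseudomonotone_on_def B_def by force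
      then have "S \<subseteq> {x. inner (F z) x < inner (F z) z}" by (auto simp: inner_diff_right)
      then have "convex hull S \<subseteq> {x. inner (F z) x < inner (F z) z}"
        by (intro hull_minimal convex_halfspace_lt)
      with z show False by auto
    qed
  qed
  have fin: "(\<Inter>x\<in>J. C \<inter> B x) \<noteq> {}" if J: "finite J" "J \<subseteq> C" for J
  proof (cases "J = {}")
    case False
    have "convex hull J \<inter> (\<Inter>x\<in>J. B x) \<noteq> {}"
      using J kkm by (intro convex_KKM False) (auto simp: B_ball finite_subset)
    moreover have "convex hull J \<subseteq> C" using J C(2) by (intro hull_minimal) auto
    ultimately show ?thesis by blast
  qed simp
  obtain x0 where x0: "x0 \<in> C" using C(3) by auto
  have "(\<Inter>x\<in>C. C \<inter> B x) \<noteq> {}"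
    by (rule closed_convex_finite_intersection_property[OF _ _ x0 _ fin])
      (use C in \<open>auto simp: B_ball intro: closed_Int convex_Int bounded_Int\<close>)
  then obtain y where y: "y \<in> C" "\<And>x. x \<in> C \<Longrightarrow> y \<in> B x" using x0 by blast
  \<comment> \<open>Minty's argument: test at points of the segment from y to v and let them tend to y.\<close>
  have "inner (F y) (v - y) \<ge> 0" if v: "v \<in> C" for v
  proof -
    define c where "c t = y + t *\<^sub>R (v - y)" for t :: real
    have cC: "c t \<in> C" if "t \<in> {0..1}" for t
    proof -
      have "c t = (1 - t) *\<^sub>R y + t *\<^sub>R v" by (simp add: c_def algebra_simps)
      then show ?thesis using convexD[OF C(2) y(1) v, of "1 - t" t] that by auto
    qed
    have "continuous_on {0..1} (\<lambda>t. inner (F (c t)) (v - y))"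
      unfolding c_def using cC c_def
      by (intro continuous_intros continuous_on_compose2[OF F(1)]) auto
    then have "((\<lambda>t. inner (F (c t)) (v - y)) \<longlongrightarrow> inner (F (c 0)) (v - y)) (at 0 within {0..1})"
      by (simp add: continuous_on_def)
    then have lim: "((\<lambda>t. inner (F (c t)) (v - y)) \<longlongrightarrow> inner (F y) (v - y)) (at_right 0)"
      by (simp add: at_within_Icc_at_right c_def)
    have "inner (F (c t)) (v - y) \<ge> 0" if t: "0 < t" "t < 1" for t
    proof -
      have "y \<in> B (c t)" using t by (intro y cC) auto
      then have "\<eta> * (norm (c t - y))\<^sup>2 \<le> inner (F (c t)) (c t - y)" by (simp add: B_def)
      moreover have "\<eta> * (norm (c t - y))\<^sup>2 \<ge> 0" using \<eta> by simp
      ultimately have "0 \<le> t * inner (F (c t)) (v - y)" by (simp add: c_def)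
      then show ?thesis using t by (simp add: zero_le_mult_iff)
    qed
    then have "eventually (\<lambda>t. inner (F (c t)) (v - y) \<ge> 0) (at_right 0)"
      by (intro eventually_at_rightI[of 0 1]) auto
    then show ?thesis by (intro tendsto_lowerbound[OF lim]) auto
  qed
  with y(1) show ?thesis by (auto simp: vi_solution_def)
qed

text \<open>
  The solution \<open>y'\<close> is the projection onto \<open>C'\<close> of \<open>w = y' - \<rho> F' y'\<close>, so \<open>z = metric_proj C w\<close> is
  within \<open>h\<close> of \<open>y'\<close>.  As \<open>z\<close> and \<open>y\<close> both belong to \<open>C\<close>, strong pseudomonotonicity bounds
  \<open>norm (z - y)\<close>: the projection inequality for \<open>z\<close> turns \<open>F' y'\<close> into a multiple of \<open>y' - z\<close> divided
  by \<open>\<rho>\<close>, and the Lipschitz estimate controls \<open>F z - F' y'\<close>.  The term with \<open>1/\<rho>\<close> is made small by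
  a large \<open>\<rho>\<close>; the distance \<open>norm (z - y')\<close> remains at most \<open>h\<close> throughout.
\<close>

lemma vi_solution_sensitivity:
  fixes C C' :: "'a::{real_inner,complete_space} set"
  assumes C: "closed C" "convex C" and C': "closed C'" "convex C'"
    and y: "vi_solution C F y" and y': "vi_solution C' F' y'"
    and mono: "strongly_pseudomonotone_on C \<eta> F" and \<eta>: "\<eta> > 0"
    and l: "l \<ge> 0" and lip: "\<And>z. z \<in> C \<Longrightarrow> norm (F z - F' y') \<le> l * (\<delta> + norm (z - y'))"
    and h: "\<And>w. norm (metric_proj C w - metric_proj C' w) \<le> h"
  shows "norm (y - y') \<le> (1 + l / \<eta>) * h + l / \<eta> * \<delta>"
proof (rule field_le_epsilon)
  fix \<epsilon> :: real assume \<epsilon>: "\<epsilon> > 0"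
  have h0: "h \<ge> 0" using h norm_ge_zero order_trans by blast
  \<comment> \<open>Large enough for the remainder h / (\<rho> * \<eta>) to be at most \<epsilon>; the summand 1 keeps \<rho> positive
    when h = 0.\<close>
  define \<rho> where "\<rho> = (h + 1) / (\<eta> * \<epsilon>)"
  have \<rho>: "\<rho> > 0" using h0 \<eta> \<epsilon> by (simp add: \<rho>_def)
  define w where "w = y' - \<rho> *\<^sub>R F' y'"
  define z where "z = metric_proj C w"
  have yC: "y \<in> C" "y' \<in> C'" and sol: "\<And>v. v \<in> C \<Longrightarrow> inner (F y) (v - y) \<ge> 0"
      "\<And>v. v \<in> C' \<Longrightarrow> inner (F' y') (v - y') \<ge> 0"
    using y y' by (auto simp: vi_solution_def)
  have "metric_proj C' w = y'"
    using yC sol(2) \<rho> by (intro metric_proj_eqI C') (auto simp: w_def)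
  then have e: "norm (z - y') \<le> h" using h[of w] by (simp add: z_def)
  have z: "z \<in> C" "inner (w - z) (y - z) \<le> 0"
    using metric_proj_properties[OF C, where w = w] yC by (auto simp: z_def)
  have "\<eta> * (norm (z - y))\<^sup>2 \<le> inner (F z) (z - y)"
    using mono z(1) yC(1) sol(1)[OF z(1)] by (auto simp: strongly_pseudomonotone_on_def)
  then have "\<rho> * (\<eta> * (norm (z - y))\<^sup>2) \<le> \<rho> * inner (F z) (z - y)"
    using \<rho> by (intro mult_left_mono) auto
  also have "\<dots> = \<rho> * inner (F z - F' y') (z - y) + inner (y' - z) (z - y) + inner (w - z) (y - z)"
    by (simp add: w_def inner_diff inner_commute algebra_simps)
  also have "\<dots> \<le> \<rho> * (l * (\<delta> + h) * norm (z - y)) + h * norm (z - y)"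
  proof -
    have "norm (F z - F' y') \<le> l * (\<delta> + h)"
      using lip[OF z(1)] mult_left_mono[OF add_left_mono[OF e] l, of \<delta>] by linarith
    then have "inner (F z - F' y') (z - y) \<le> l * (\<delta> + h) * norm (z - y)"
      by (intro order_trans[OF norm_cauchy_schwarz] mult_right_mono) auto
    moreover have "inner (y' - z) (z - y) \<le> h * norm (z - y)"
      using e by (intro order_trans[OF norm_cauchy_schwarz] mult_right_mono) (auto simp: norm_minus_commute)
    ultimately show ?thesis
      using z(2) mult_left_mono[of _ _ \<rho>] \<rho> by (smt (verit))
  qed
  finally have "norm (z - y) * (\<rho> * \<eta> * norm (z - y)) \<le> norm (z - y) * (\<rho> * l * (\<delta> + h) + h)"
    by (simp add: power2_eq_square algebra_simps)
  moreover have rhs: "0 \<le> \<rho> * l * (\<delta> + h) + h"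
  proof -
    have "0 \<le> l * (\<delta> + norm (z - y'))" using lip[OF z(1)] norm_ge_zero order_trans by blast
    also have "\<dots> \<le> l * (\<delta> + h)" using e l by (intro mult_left_mono) auto
    finally show ?thesis using \<rho> h0 by (simp add: mult.assoc)
  qed
  ultimately have "\<rho> * \<eta> * norm (z - y) \<le> \<rho> * l * (\<delta> + h) + h"
    by (cases "z = y") (auto simp: mult_le_cancel_left)
  then have "norm (z - y) \<le> l / \<eta> * (\<delta> + h) + h / (\<rho> * \<eta>)"
    using \<rho> \<eta> by (simp add: field_simps)
  moreover have "h / (\<rho> * \<eta>) \<le> \<epsilon>"
  proof -
    have "h / (\<rho> * \<eta>) = \<epsilon> * (h / (h + 1))" using \<eta> \<epsilon> by (simp add: \<rho>_def)
    also have "\<dots> \<le> \<epsilon> * 1" using h0 \<epsilon> by (intro mult_left_mono) auto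
    finally show ?thesis by simp
  qed
  moreover have "norm (y - y') \<le> norm (z - y) + norm (z - y')"
    using norm_triangle_ineq[of "y - z" "z - y'"] by (simp add: norm_minus_commute)
  ultimately show "norm (y - y') \<le> (1 + l / \<eta>) * h + l / \<eta> * \<delta> + \<epsilon>"
    using e unfolding ring_distribs by linarith
qed

section \<open>The constants\<close>

text \<open>
  Since \<open>sqrt (4 * l\<^sup>2 + 2 * \<eta>\<^sup>2) \<ge> 2 * l\<close>, the bracket on the right is at least \<open>4 * l\<^sup>2 + \<eta>\<^sup>2\<close>;
  and by Cauchy and Schwarz \<open>(\<eta> + l)\<^sup>2 \<le> (1 + 1/4) * (\<eta>\<^sup>2 + 4 * l\<^sup>2)\<close>.
\<close>

lemma contraction_constant_bound:
  fixes l \<eta> k :: real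
  assumes "l > 0" "\<eta> > 0"
  shows "((1 + l / \<eta>) * k)\<^sup>2 \<le>
    5/8 * (2 * (k\<^sup>2 / \<eta>\<^sup>2) * (l * sqrt (4 * l\<^sup>2 + 2 * \<eta>\<^sup>2) + 2 * l\<^sup>2 + \<eta>\<^sup>2))"
proof -
  define Q where "Q = l * sqrt (4 * l\<^sup>2 + 2 * \<eta>\<^sup>2) + 2 * l\<^sup>2 + \<eta>\<^sup>2"
  have "2 * l \<le> sqrt (4 * l\<^sup>2 + 2 * \<eta>\<^sup>2)"
    by (rule real_le_rsqrt) (simp add: power2_eq_square)
  then have "l * (2 * l) \<le> l * sqrt (4 * l\<^sup>2 + 2 * \<eta>\<^sup>2)"
    using assms by (intro mult_left_mono) auto
  then have "2 * l\<^sup>2 \<le> l * sqrt (4 * l\<^sup>2 + 2 * \<eta>\<^sup>2)"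
    by (simp add: power2_eq_square)
  then have "5/4 * (4 * l\<^sup>2 + \<eta>\<^sup>2) \<le> 5/4 * Q"
    by (simp add: Q_def)
  moreover have "5/4 * (4 * l\<^sup>2 + \<eta>\<^sup>2) = (\<eta> + l)\<^sup>2 + (2 * l - \<eta> / 2)\<^sup>2"
    by (simp add: power2_eq_square field_simps)
  then have "(\<eta> + l)\<^sup>2 \<le> 5/4 * (4 * l\<^sup>2 + \<eta>\<^sup>2)"
    by simp
  ultimately have "(\<eta> + l)\<^sup>2 \<le> 5/4 * Q"
    by (rule order_trans[rotated])
  then have "(k\<^sup>2 / \<eta>\<^sup>2) * (\<eta> + l)\<^sup>2 \<le> (k\<^sup>2 / \<eta>\<^sup>2) * (5/4 * Q)"
    by (intro mult_left_mono) auto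
  moreover have "(k\<^sup>2 / \<eta>\<^sup>2) * (\<eta> + l)\<^sup>2 = ((1 + l / \<eta>) * k)\<^sup>2"
    using assms by (simp add: field_simps power2_eq_square)
  ultimately show ?thesis
    unfolding Q_def[symmetric] by (simp add: mult_ac)
qed

text \<open>
  With \<open>S\<close> for the square root, this is \<open>(S + l)\<^sup>2 \<ge> 4 * S * l\<close>.
\<close>

lemma sensitivity_constant_bound:
  fixes l \<eta> :: real
  assumes "l > 0" "\<eta> > 0"
  shows "8 * (l / \<eta>)\<^sup>2 \<le>
    2 * ((l * (sqrt (l\<^sup>2 + \<eta>\<^sup>2 / 2) + l)\<^sup>2) / (\<eta>\<^sup>2 * sqrt (l\<^sup>2 + \<eta>\<^sup>2 / 2)))"
proof -
  define S where "S = sqrt (l\<^sup>2 + \<eta>\<^sup>2 / 2)"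
  have S: "S > 0" using assms by (simp add: S_def add_pos_pos)
  have "4 * (S * l) \<le> (S + l)\<^sup>2"
    using zero_le_power2[of "S - l"] by (simp add: power2_eq_square algebra_simps)
  then have "2 * (l / (\<eta>\<^sup>2 * S)) * (4 * (S * l)) \<le> 2 * (l / (\<eta>\<^sup>2 * S)) * (S + l)\<^sup>2"
    using assms S by (intro mult_left_mono) auto
  moreover have "2 * (l / (\<eta>\<^sup>2 * S)) * (4 * (S * l)) = 8 * (l / \<eta>)\<^sup>2"
    using S assms by (simp add: field_simps power2_eq_square)
  ultimately show ?thesis by (simp add: S_def)
qed

text \<open>
  The linear estimate is squared with weights \<open>8/5\<close> and \<open>8/3\<close>, whose reciprocals add up to 1.  The
  first is chosen so that the square of \<open>c * d\<close> contributes at most \<open>L * d\<^sup>2\<close>, which is absorbed on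
  the left; the second stays below the factor 8 that \<open>\<kappa>\<close> affords.
\<close>

lemma linear_estimate_imp_sqrt_estimate:
  fixes d \<delta> c r L \<kappa> :: real
  assumes d: "d \<le> c * d + r * \<delta>" and nonneg: "d \<ge> 0" "\<delta> \<ge> 0"
    and L: "c\<^sup>2 \<le> 5/8 * L" "L < 1" and \<kappa>: "8 * r\<^sup>2 \<le> \<kappa>"
  shows "d \<le> sqrt (\<kappa> / (1 - L)) * \<delta>"
proof -
  define p q where "p = c * d" and "q = r * \<delta>"
  have "d\<^sup>2 \<le> (p + q)\<^sup>2" using d nonneg by (intro power_mono) (auto simp: p_def q_def)
  moreover have "8/5 * p\<^sup>2 + 8/3 * q\<^sup>2 - (p + q)\<^sup>2 = (3 * p - 5 * q)\<^sup>2 / 15"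
    by (simp add: power2_eq_square field_simps)
  then have "(p + q)\<^sup>2 \<le> 8/5 * p\<^sup>2 + 8/3 * q\<^sup>2"
    using zero_le_power2[of "3 * p - 5 * q"] by linarith
  moreover have "8/5 * p\<^sup>2 \<le> L * d\<^sup>2"
    using mult_right_mono[OF L(1), of "d\<^sup>2"] by (simp add: p_def power_mult_distrib)
  moreover have "8 * q\<^sup>2 \<le> \<kappa> * \<delta>\<^sup>2"
    using mult_right_mono[OF \<kappa>, of "\<delta>\<^sup>2"] by (simp add: q_def power_mult_distrib)
  moreover have "(1 - L) * d\<^sup>2 = d\<^sup>2 - L * d\<^sup>2" "q\<^sup>2 \<ge> 0"
    by (simp_all add: left_diff_distrib)
  ultimately have "(1 - L) * d\<^sup>2 \<le> \<kappa> * \<delta>\<^sup>2"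
    by linarith
  then have "d\<^sup>2 \<le> \<kappa> / (1 - L) * \<delta>\<^sup>2" using L(2) by (simp add: field_simps)
  then have "d \<le> sqrt (\<kappa> / (1 - L) * \<delta>\<^sup>2)" by (rule real_le_rsqrt)
  then show ?thesis
    unfolding real_sqrt_mult using nonneg by simp
qed

section \<open>The quasi-variational inequality\<close>

theorem lemma3p2:
  fixes T l\<^sub>G \<eta>\<^sub>G l\<^sub>K L \<kappa> :: real
    and \<Omega> :: "'b::{real_inner,complete_space} set"
    and K :: "'b \<Rightarrow> 'b set"
    and G :: "real \<Rightarrow> 'a::{real_inner,complete_space} \<Rightarrow> 'b \<Rightarrow> 'b"
  assumes T: "T > 0"
    and \<Omega>: "\<Omega> \<noteq> {}" "closed \<Omega>" "convex \<Omega>"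
    and K: "\<And>u. u \<in> \<Omega> \<Longrightarrow> K u \<subseteq> \<Omega> \<and> K u \<noteq> {} \<and> closed (K u) \<and> convex (K u)"
    and consts_pos: "l\<^sub>G > 0" "\<eta>\<^sub>G > 0"
    and G_lipschitz: "\<And>s\<^sub>1 s\<^sub>2 x\<^sub>1 x\<^sub>2 u\<^sub>1 u\<^sub>2.
      \<lbrakk>s\<^sub>1 \<in> {0..T}; s\<^sub>2 \<in> {0..T}; u\<^sub>1 \<in> \<Omega>; u\<^sub>2 \<in> \<Omega>\<rbrakk> \<Longrightarrow>
      norm (G s\<^sub>2 x\<^sub>2 u\<^sub>2 - G s\<^sub>1 x\<^sub>1 u\<^sub>1) \<le> l\<^sub>G * (\<bar>s\<^sub>2 - s\<^sub>1\<bar> + norm (x\<^sub>2 - x\<^sub>1) + norm (u\<^sub>2 - u\<^sub>1))"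
    and G_pseudomonotone: "\<And>s x u u\<^sub>1 u\<^sub>2.
      \<lbrakk>s \<in> {0..T}; u \<in> \<Omega>; u\<^sub>1 \<in> K u; u\<^sub>2 \<in> K u; inner (G s x u\<^sub>2) (u\<^sub>1 - u\<^sub>2) \<ge> 0\<rbrakk> \<Longrightarrow>
      inner (G s x u\<^sub>1) (u\<^sub>1 - u\<^sub>2) \<ge> \<eta>\<^sub>G * (norm (u\<^sub>1 - u\<^sub>2))\<^sup>2"
    and l\<^sub>K_nonneg: "l\<^sub>K \<ge> 0"
    and K_lipschitz: "\<And>u\<^sub>1 u\<^sub>2 w. \<lbrakk>u\<^sub>1 \<in> \<Omega>; u\<^sub>2 \<in> \<Omega>\<rbrakk> \<Longrightarrow>
      norm (metric_proj (K u\<^sub>2) w - metric_proj (K u\<^sub>1) w) \<le> l\<^sub>K * norm (u\<^sub>2 - u\<^sub>1)"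
    and L_eq: "L = 2 * (l\<^sub>K\<^sup>2 / \<eta>\<^sub>G\<^sup>2) * (l\<^sub>G * sqrt (4 * l\<^sub>G\<^sup>2 + 2 * \<eta>\<^sub>G\<^sup>2) + 2 * l\<^sub>G\<^sup>2 + \<eta>\<^sub>G\<^sup>2)"
    and L_less: "L < 1"
    and \<kappa>_eq: "\<kappa> = 2 * ((l\<^sub>G * (sqrt (l\<^sub>G\<^sup>2 + \<eta>\<^sub>G\<^sup>2 / 2) + l\<^sub>G)\<^sup>2) / (\<eta>\<^sub>G\<^sup>2 * sqrt (l\<^sub>G\<^sup>2 + \<eta>\<^sub>G\<^sup>2 / 2)))"
  shows "(\<forall>s\<in>{0..T}. \<forall>x. continuous_on {0..T} x \<longrightarrow> (\<exists>!u. qvi_solution \<Omega> K (G s (x s)) u))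
    \<and> (\<forall>x u. continuous_on {0..T} x \<and> qvi_solution_function T \<Omega> K G x u \<longrightarrow> continuous_on {0..T} u)
    \<and> (\<forall>x\<^sub>1 x\<^sub>2 u\<^sub>1 u\<^sub>2. continuous_on {0..T} x\<^sub>1 \<and> continuous_on {0..T} x\<^sub>2
          \<and> qvi_solution_function T \<Omega> K G x\<^sub>1 u\<^sub>1 \<and> qvi_solution_function T \<Omega> K G x\<^sub>2 u\<^sub>2 \<longrightarrow>
        (\<forall>s\<in>{0..T}. norm (u\<^sub>1 s - u\<^sub>2 s) \<le> sqrt (\<kappa> / (1 - L)) * norm (x\<^sub>1 s - x\<^sub>2 s)))"
proof -
  define c r where "c = (1 + l\<^sub>G / \<eta>\<^sub>G) * l\<^sub>K" and "r = l\<^sub>G / \<eta>\<^sub>G"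
  have c2: "c\<^sup>2 \<le> 5/8 * L"
    unfolding c_def L_eq by (rule contraction_constant_bound[OF consts_pos])
  have r2: "8 * r\<^sup>2 \<le> \<kappa>"
    unfolding r_def \<kappa>_eq by (rule sensitivity_constant_bound[OF consts_pos])
  have c0: "c \<ge> 0" using consts_pos l\<^sub>K_nonneg by (simp add: c_def)
  have "c\<^sup>2 < 1\<^sup>2" using c2 L_less zero_le_power2[of c] by simp
  then have c1: "c < 1" by (rule power_less_imp_less_base) simp
  have qvi_iff: "qvi_solution \<Omega> K F u \<longleftrightarrow> u \<in> \<Omega> \<and> vi_solution (K u) F u" for F u
    by (auto simp: qvi_solution_def vi_solution_def)
  have mono: "strongly_pseudomonotone_on (K u) \<eta>\<^sub>G (G s x)" if "s \<in> {0..T}" "u \<in> \<Omega>" for s x u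
    using G_pseudomonotone[OF that] by (auto simp: strongly_pseudomonotone_on_def)
  have sens: "norm (y - y') \<le> c * norm (u - u') + r * (\<bar>s - s'\<bar> + norm (x - x'))"
    if "s \<in> {0..T}" "s' \<in> {0..T}" "u \<in> \<Omega>" "u' \<in> \<Omega>"
      "vi_solution (K u) (G s x) y" "vi_solution (K u') (G s' x') y'" for s s' x x' u u' y y'
  proof -
    have y': "y' \<in> \<Omega>" using that K[of u'] by (auto simp: vi_solution_def)
    have "norm (y - y') \<le> (1 + l\<^sub>G / \<eta>\<^sub>G) * (l\<^sub>K * norm (u - u'))
        + l\<^sub>G / \<eta>\<^sub>G * (\<bar>s - s'\<bar> + norm (x - x'))"
    proof (rule vi_solution_sensitivity[OF _ _ _ _ that(5,6) mono[OF that(1,3)]])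
      show "norm (G s x z - G s' x' y') \<le> l\<^sub>G * (\<bar>s - s'\<bar> + norm (x - x') + norm (z - y'))"
        if "z \<in> K u" for z
        using K[of u] \<open>u \<in> \<Omega>\<close> that y' by (intro G_lipschitz) (use \<open>s \<in> _\<close> \<open>s' \<in> _\<close> in auto)
      show "norm (metric_proj (K u) w - metric_proj (K u') w) \<le> l\<^sub>K * norm (u - u')" for w
        using that by (intro K_lipschitz)
    qed (use K that consts_pos in auto)
    then show ?thesis by (simp add: c_def r_def)
  qed
  have qvi_sens: "norm (u - u') \<le> c * norm (u - u') + r * (\<bar>s - s'\<bar> + norm (x - x'))"
    if "s \<in> {0..T}" "s' \<in> {0..T}" "qvi_solution \<Omega> K (G s x) u" "qvi_solution \<Omega> K (G s' x') u'"
    for s s' x x' u u'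
    using that by (intro sens) (auto simp: qvi_iff)
  have ex1: "\<exists>!u. qvi_solution \<Omega> K (G s x) u" if s: "s \<in> {0..T}" for s x
  proof -
    have cont: "continuous_on \<Omega> (G s x)"
    proof (rule lipschitz_on_continuous_on)
      show "l\<^sub>G-lipschitz_on \<Omega> (G s x)"
        using G_lipschitz[OF s s, of _ _ x x] consts_pos
        by (intro lipschitz_onI) (auto simp: dist_norm)
    qed
    have "\<exists>y. vi_solution (K u) (G s x) y" if "u \<in> \<Omega>" for u
      using K[OF that] mono[OF s that] consts_pos
      by (intro vi_solution_exists[of _ \<eta>\<^sub>G]) (auto intro: continuous_on_subset[OF cont])
    then obtain \<Phi> where \<Phi>: "\<And>u. u \<in> \<Omega> \<Longrightarrow> vi_solution (K u) (G s x) (\<Phi> u)" by metis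
    have "\<exists>!u\<in>\<Omega>. \<Phi> u = u"
    proof (rule Banach_fix[OF _ _ c0 c1])
      show "complete \<Omega>" using \<Omega>(2) by (simp add: complete_eq_closed)
      show "\<Phi> ` \<Omega> \<subseteq> \<Omega>" using \<Phi> K by (auto simp: vi_solution_def)
      show "dist (\<Phi> u) (\<Phi> v) \<le> c * dist u v" if "u \<in> \<Omega>" "v \<in> \<Omega>" for u v
        using sens[OF s s that \<Phi>[OF that(1)] \<Phi>[OF that(2)]] by (simp add: dist_norm)
    qed (rule \<Omega>)
    then obtain u where "u \<in> \<Omega>" "\<Phi> u = u" by blast
    then have "qvi_solution \<Omega> K (G s x) u" using \<Phi>[of u] by (simp add: qvi_iff)
    moreover have "v = u" if "qvi_solution \<Omega> K (G s x) u" "qvi_solution \<Omega> K (G s x) v" for u v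
    proof -
      have "(1 - c) * norm (v - u) \<le> 0"
        using qvi_sens[OF s s that(2,1)] by (simp add: algebra_simps)
      then show ?thesis using c1 by (simp add: mult_le_0_iff)
    qed
    ultimately show ?thesis by blast
  qed
  have cont: "continuous_on {0..T} u"
    if x: "continuous_on {0..T} x" and u: "qvi_solution_function T \<Omega> K G x u" for x u
    unfolding continuous_on_def
  proof
    fix s assume s: "s \<in> {0..T}"
    define bound where "bound t = r * (\<bar>t - s\<bar> + norm (x t - x s)) / (1 - c)" for t
    have "(x \<longlongrightarrow> x s) (at s within {0..T})" using x s by (simp add: continuous_on_def)
    then have "(bound \<longlongrightarrow> r * (\<bar>s - s\<bar> + norm (x s - x s)) / (1 - c)) (at s within {0..T})"
      unfolding bound_def using c1 by (intro tendsto_intros) auto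
    then have lim: "(bound \<longlongrightarrow> 0) (at s within {0..T})" by simp
    have "dist (u t) (u s) \<le> bound t" if "t \<in> {0..T}" for t
      using qvi_sens[OF that s, of "x t" "u t" "x s" "u s"] u that s c1
      by (simp add: qvi_solution_function_def bound_def dist_norm field_simps)
    then have "eventually (\<lambda>t. dist (u t) (u s) \<le> bound t) (at s within {0..T})"
      by (simp add: eventually_at_filter)
    then have "((\<lambda>t. dist (u t) (u s)) \<longlongrightarrow> 0) (at s within {0..T})"
      by (intro tendsto_sandwich[OF _ _ tendsto_const lim]) auto
    then show "(u \<longlongrightarrow> u s) (at s within {0..T})" by (simp add: tendsto_dist_iff[symmetric])
  qed
  have est: "norm (u\<^sub>1 s - u\<^sub>2 s) \<le> sqrt (\<kappa> / (1 - L)) * norm (x\<^sub>1 s - x\<^sub>2 s)"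
    if "qvi_solution_function T \<Omega> K G x\<^sub>1 u\<^sub>1" "qvi_solution_function T \<Omega> K G x\<^sub>2 u\<^sub>2" "s \<in> {0..T}"
    for x\<^sub>1 x\<^sub>2 u\<^sub>1 u\<^sub>2 s
    using qvi_sens[of s s "x\<^sub>1 s" "u\<^sub>1 s" "x\<^sub>2 s" "u\<^sub>2 s"] that
    by (intro linear_estimate_imp_sqrt_estimate[OF _ _ _ c2 L_less r2])
      (auto simp: qvi_solution_function_def)
  show ?thesis
    by (intro conjI allI impI ballI; (elim conjE)?) (rule ex1 cont est; assumption)+
qed

end
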